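(* Let $\mathfrak g$ be a real Lie algebra and $M$ a Lie representation of $\mathfrak g$. The maps $$\tau^n: CL^n(\mathfrak g,M^a)\to CL^{n-1}(\mathfrak g,Hom(\mathfrak g,M)^s),\qquad \tau^n(\omega)(x_1,\dots,x_{n-1})(x_n)=\omega(x_1,\dots,x_n)\qquad(n\ge1)$$ form an isomorphism of cochain complexes: each $\tau^n$ is a linear isomorphism and $dL^{n-1}\circ\tau^n=\tau^{n+1}\circ dL^n$.
   Context: A representation of a (left) Leibniz algebra $\mathfrak g$ is a vector space $M$ with bilinear maps $[-,-]_L:\mathfrak g\times M\to M$ and $[-,-]_R:M\times\mathfrak g\to M$ satisfying $[x,[y,m]_L]_L=[[x,y],m]_L+[y,[x,m]_L]_L$, $[x,[m,y]_R]_L=[[x,m]_L,y]_R+[m,[x,y]]_R$, $[m,[x,y]]_R=[[m,x]_R,y]_R+[x,[m,y]_R]_L$. If $\mathfrak g$ is a Lie algebra and $N$ a Lie representation of it, $N^s$ (symmetric) denotes $N$ with $[x,m]_L=x.m$, $[m,x]_R=-x.m$, and $N^a$ (anti-symmetric) denotes $N$ with $[x,m]_L=x.m$, $[m,x]_R=0$. $Hom(\mathfrak g,M)$ is a Lie representation via $(x.\alpha)(y)=x.(\alpha(y))-\alpha([x,y])$. For a representation $M$: $CL^n(\mathfrak g,M)=Hom(\mathfrak g^{\otimes n},M)$ and $$dL^n\omega(x_0,\dots,x_n)=\sum_{i=0}^{n-1}(-1)^i[x_i,\omega(x_0,\dots,\widehat{x_i},\dots,x_n)]_L+(-1)^{n-1}[\omega(x_0,\dots,x_{n-1}),x_n]_R+\sum_{0\le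 i<j\le n}(-1)^{i+1}\omega(x_0,\dots,\widehat{x_i},\dots,x_{j-1},[x_i,x_j],x_{j+1},\dots,x_n).$$ *)

theory Defs
  imports "HOL-Analysis.Analysis"
begin

section \<open>Lie and Leibniz algebras and their representations\<close>

locale leibniz_algebra =
  fixes br :: "'g::real_vector \<Rightarrow> 'g \<Rightarrow> 'g"
  assumes br_bilinear: "bilinear br"
    and leibniz: "br x (br y z) = br (br x y) z + br y (br x z)"

locale lie_algebra =
  fixes br :: "'g::real_vector \<Rightarrow> 'g \<Rightarrow> 'g"
  assumes br_bilinear: "bilinear br"
    and br_self: "br x x = 0"
    and jacobi: "br x (br y z) + br y (br z x) + br z (br x y) = 0"
begin

lemma br_skew: "br x y = - br y x"
proof -
  have "br (x + y) (x + y) = br x x + br x y + (br y x + br y y)"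
    by (simp add: bilinear_ladd[OF br_bilinear] bilinear_radd[OF br_bilinear])
  then show ?thesis
    unfolding br_self by (simp add: eq_neg_iff_add_eq_0)
qed

sublocale leibniz_algebra br
proof
  fix x y z
  have "br x (br y z) = - br y (br z x) - br z (br x y)"
    using jacobi[of x y z] by (simp add: algebra_simps add_eq_0_iff2)
  also have "br y (br z x) = - br y (br x z)"
    using br_bilinear by (subst br_skew) (simp add: bilinear_rneg)
  also have "br z (br x y) = - br (br x y) z"
    by (rule br_skew)
  finally show "br x (br y z) = br (br x y) z + br y (br x z)" by simp
qed (rule br_bilinear)

end

locale lie_rep = lie_algebra br
  for br :: "'g::real_vector \<Rightarrow> 'g \<Rightarrow> 'g" +
  fixes act :: "'g \<Rightarrow> 'm::real_vector \<Rightarrow> 'm"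
  assumes act_bilinear: "bilinear act"
    and act_br: "act (br x y) m = act x (act y m) - act y (act x m)"

text \<open>A representation of a Leibniz algebra is a pair of operations: the left one
  \<open>[x, m]\<^sub>L\<close> and the right one \<open>[m, x]\<^sub>R\<close>.\<close>

type_synonym ('g, 'm) ops = "('g \<Rightarrow> 'm \<Rightarrow> 'm) \<times> ('m \<Rightarrow> 'g \<Rightarrow> 'm)"

locale leibniz_rep = leibniz_algebra br
  for br :: "'g::real_vector \<Rightarrow> 'g \<Rightarrow> 'g" +
  fixes M :: "('g, 'm::real_vector) ops"
  assumes left_bilinear: "bilinear (fst M)"
    and right_bilinear: "bilinear (snd M)"
    and LLM: "fst M x (fst M y m) = fst M (br x y) m + fst M y (fst M x m)"
    and LML: "fst M x (snd M m y) = snd M (fst M x m) y + snd M m (br x y)"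
    and MLL: "snd M m (br x y) = snd M (snd M m x) y + fst M x (snd M m y)"

definition sym_rep :: "('g \<Rightarrow> 'm \<Rightarrow> 'm) \<Rightarrow> ('g, 'm::real_vector) ops" where
  "sym_rep act = (act, \<lambda>m x. - act x m)"

definition antisym_rep :: "('g \<Rightarrow> 'm \<Rightarrow> 'm) \<Rightarrow> ('g, 'm::real_vector) ops" where
  "antisym_rep act = (act, \<lambda>m x. 0)"

context lie_rep
begin

lemma leibniz_rep_sym: "leibniz_rep br (sym_rep act)"
proof
  show "bilinear (snd (sym_rep act))"
    using act_bilinear
    by (auto simp: sym_rep_def bilinear_def intro: linear_compose_neg)
qed (use act_bilinear in \<open>auto simp: sym_rep_def act_br bilinear_rneg\<close>)

lemma leibniz_rep_antisym: "leibniz_rep br (antisym_rep act)"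
proof
  show "bilinear (snd (antisym_rep act))"
    by (auto simp: antisym_rep_def bilinear_def linear_zero)
qed (use act_bilinear in \<open>auto simp: antisym_rep_def act_br bilinear_rzero\<close>)

end

section \<open>The representation \<open>Hom(\<gg>, M)\<close>\<close>

typedef (overloaded) ('g, 'm) lin = "{f :: 'g::real_vector \<Rightarrow> 'm::real_vector. linear f}"
  morphisms lin_apply Lin
  by (rule exI[of _ "\<lambda>x. 0"]) (simp add: linear_zero)

setup_lifting type_definition_lin

instantiation lin :: (real_vector, real_vector) real_vector
begin

lift_definition zero_lin :: "('a, 'b) lin" is "\<lambda>x. 0"
  by (rule linear_zero)
lift_definition plus_lin :: "('a, 'b) lin \<Rightarrow> ('a, 'b) lin \<Rightarrow> ('a, 'b) lin"
  is "\<lambda>f g x. f x + g x" by (rule linear_compose_add)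
lift_definition minus_lin :: "('a, 'b) lin \<Rightarrow> ('a, 'b) lin \<Rightarrow> ('a, 'b) lin"
  is "\<lambda>f g x. f x - g x" by (rule linear_compose_sub)
lift_definition uminus_lin :: "('a, 'b) lin \<Rightarrow> ('a, 'b) lin"
  is "\<lambda>f x. - f x" by (rule linear_compose_neg)
lift_definition scaleR_lin :: "real \<Rightarrow> ('a, 'b) lin \<Rightarrow> ('a, 'b) lin"
  is "\<lambda>c f x. c *\<^sub>R f x" by (rule linear_compose_scale_right)

instance
  by standard (transfer; simp add: fun_eq_iff algebra_simps)+

end

lemma linear_lin_apply: "linear (lin_apply \<alpha>)"
  using lin_apply by blast

lemma lin_apply_Lin: "linear f \<Longrightarrow> lin_apply (Lin f) = f"
  by (simp add: Lin_inverse)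

definition hom_act ::
  "('g \<Rightarrow> 'g \<Rightarrow> 'g) \<Rightarrow> ('g \<Rightarrow> 'm \<Rightarrow> 'm) \<Rightarrow> 'g \<Rightarrow> ('g::real_vector, 'm::real_vector) lin \<Rightarrow> ('g, 'm) lin"
  where "hom_act br act x \<alpha> = Lin (\<lambda>y. act x (lin_apply \<alpha> y) - lin_apply \<alpha> (br x y))"

lemma (in lie_rep) hom_act_apply:
  "lin_apply (hom_act br act x \<alpha>) y = act x (lin_apply \<alpha> y) - lin_apply \<alpha> (br x y)"
proof -
  have "linear (\<lambda>y. act x (lin_apply \<alpha> y) - lin_apply \<alpha> (br x y))"
    using linear_lin_apply[of \<alpha>] br_bilinear act_bilinear
    by (auto simp: linear_iff bilinear_radd bilinear_rmul algebra_simps)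
  then show ?thesis
    by (simp add: hom_act_def lin_apply_Lin)
qed

lemma (in lie_rep) lie_rep_hom: "lie_rep br (hom_act br act)"
proof
  show "bilinear (hom_act br act)"
    unfolding bilinear_def
    using br_bilinear act_bilinear
    by (auto simp: linear_add[OF linear_lin_apply] linear_scale[OF linear_lin_apply]
        linear_iff lin_apply_inject[symmetric] fun_eq_iff hom_act_apply
        plus_lin.rep_eq scaleR_lin.rep_eq bilinear_radd bilinear_rmul bilinear_ladd bilinear_lmul
        algebra_simps)
  fix x y and \<alpha> :: "('g, 'm) lin"
  have *: "lin_apply \<alpha> (br (br x y) z) = lin_apply \<alpha> (br x (br y z)) - lin_apply \<alpha> (br y (br x z))" for z
    using leibniz[of x y z] linear_lin_apply[of \<alpha>] by (simp add: linear_add)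
  show "hom_act br act (br x y) \<alpha> =
      hom_act br act x (hom_act br act y \<alpha>) - hom_act br act y (hom_act br act x \<alpha>)"
    using act_bilinear
    by (simp add: lin_apply_inject[symmetric] fun_eq_iff hom_act_apply minus_lin.rep_eq act_br *
        bilinear_rsub)
qed

section \<open>Leibniz cochains\<close>

text \<open>A linear map on the \<open>n\<close>-fold tensor power is the same as an \<open>n\<close>-linear map.  The argument
  tuple is a list, and the function is extended by \<open>0\<close> to lists whose length is not \<open>n\<close>, so that
  equality of cochains is equality of functions.  The vector space structure is pointwise.\<close>

definition CL :: "nat \<Rightarrow> ('g::real_vector list \<Rightarrow> 'm::real_vector) set" where
  "CL n = {\<omega>. (\<forall>xs. length xs \<noteq> n \<longrightarrow> \<omega> xs = 0) \<and>
             (\<forall>xs i. length xs = n \<longrightarrow> i < n \<longrightarrow> linear (\<lambda>v. \<omega> (xs[i := v])))}"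

definition omit :: "nat \<Rightarrow> 'a list \<Rightarrow> 'a list" where
  "omit i xs = take i xs @ drop (Suc i) xs"

text \<open>The sign \<open>(-1)\<^bsup>n-1\<^esup>\<close> of the right action is written \<open>(-1)\<^bsup>n+1\<^esup>\<close>, because
  subtraction on \<^typ>\<open>nat\<close> would give the wrong sign for \<open>n = 0\<close>.\<close>

definition dL ::
  "('g \<Rightarrow> 'g \<Rightarrow> 'g) \<Rightarrow> ('g, 'm) ops \<Rightarrow> nat \<Rightarrow>
    ('g::real_vector list \<Rightarrow> 'm::real_vector) \<Rightarrow> 'g list \<Rightarrow> 'm" where
  "dL br M n \<omega> xs =
    (if length xs = n + 1 then
       (\<Sum>i<n. (-1) ^ i *\<^sub>R fst M (xs ! i) (\<omega> (omit i xs)))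
       + (-1) ^ (n + 1) *\<^sub>R snd M (\<omega> (omit n xs)) (xs ! n)
       + (\<Sum>j\<le>n. \<Sum>i<j. (-1) ^ (i + 1) *\<^sub>R \<omega> (omit i (xs[j := br (xs ! i) (xs ! j)])))
     else 0)"

lemma omit_update:
  assumes "k \<noteq> i" "i < length xs"
  shows "omit i (xs[k := v]) = (omit i xs)[(if k < i then k else k - 1) := v]"
proof (cases "k < i")
  case True
  then show ?thesis
    using assms by (simp add: omit_def list_update_append take_update_swap)
next
  case False
  then have "k - Suc i = k - 1 - i" "i \<le> k - 1" "Suc i \<le> k" using assms by auto
  then show ?thesis
    using assms False by (simp add: omit_def list_update_append drop_update_swap min_def)
qed

lemma omit_update_same: "omit i (xs[i := v]) = omit i xs"
  by (simp add: omit_def)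

lemma length_omit: "i < length xs \<Longrightarrow> length (omit i xs) = length xs - 1"
  by (simp add: omit_def min_def)

lemma CL_linear_omit:
  assumes "\<omega> \<in> CL n" "length xs = n + 1" "i \<le> n" "k \<le> n" "k \<noteq> i"
  shows "linear (\<lambda>v. \<omega> (omit i (xs[k := v])))"
proof -
  have "length (omit i xs) = n" "(if k < i then k else k - 1) < n"
    using assms by (auto simp: length_omit)
  then show ?thesis
    using assms by (simp add: omit_update CL_def)
qed

lemma (in leibniz_rep) dL_CL:
  assumes \<omega>: "\<omega> \<in> CL n"
  shows "dL br M n \<omega> \<in> CL (n + 1)"
  unfolding CL_def
proof (intro CollectI conjI allI impI)
  fix xs :: "'g list" and k
  assume len: "length xs = n + 1" and k: "k < n + 1"
  have left: "linear (\<lambda>v. fst M (xs[k := v] ! i) (\<omega> (omit i (xs[k := v]))))" if "i < n" for i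
  proof (cases "k = i")
    case True
    then show ?thesis
      using left_bilinear len k by (simp add: omit_update_same bilinear_def)
  next
    case False
    have "linear (\<lambda>v. \<omega> (omit i (xs[k := v])))"
      using CL_linear_omit[OF \<omega> len _ _ False] that k by simp
    moreover have "linear (fst M (xs ! i))"
      using left_bilinear by (simp add: bilinear_def)
    ultimately show ?thesis
      using False linear_compose[of "\<lambda>v. \<omega> (omit i (xs[k := v]))" "fst M (xs ! i)"]
      by (simp add: o_def)
  qed
  have right: "linear (\<lambda>v. snd M (\<omega> (omit n (xs[k := v]))) (xs[k := v] ! n))"
  proof (cases "k = n")
    case True
    then show ?thesis
      using right_bilinear len by (simp add: omit_update_same bilinear_def)
  next
    case False
    have "linear (\<lambda>v. \<omega> (omit n (xs[k := v])))"
      using CL_linear_omit[OF \<omega> len _ _ False] k by simp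
    moreover have "linear (\<lambda>m. snd M m (xs ! n))"
      using right_bilinear by (simp add: bilinear_def)
    ultimately show ?thesis
      using False linear_compose[of "\<lambda>v. \<omega> (omit n (xs[k := v]))" "\<lambda>m. snd M m (xs ! n)"]
      by (simp add: o_def)
  qed
  have inner: "linear (\<lambda>v. \<omega> (omit i ((xs[k := v])[j := br (xs[k := v] ! i) (xs[k := v] ! j)])))"
    if "i < j" "j \<le> n" for i j
  proof (cases "k = i \<or> k = j")
    case True
    have l: "linear (\<lambda>v. \<omega> (omit i (xs[j := v])))"
      using CL_linear_omit[OF \<omega> len, of i j] that by simp
    obtain f where f: "linear f"
      "\<And>v. \<omega> (omit i ((xs[k := v])[j := br (xs[k := v] ! i) (xs[k := v] ! j)]))
         = \<omega> (omit i (xs[j := f v]))"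
    proof (cases "k = i")
      case True
      have "linear (\<lambda>v. br v (xs ! j))"
        using br_bilinear by (simp add: bilinear_def)
      moreover have "omit i ((xs[i := v])[j := w]) = omit i (xs[j := w])" for v w
        using that by (metis list_update_swap nat_neq_iff omit_update_same)
      ultimately show thesis
        using that[of "\<lambda>v. br v (xs ! j)"] True len k \<open>i < j\<close> by simp
    next
      case False
      then have "k = j" using \<open>k = i \<or> k = j\<close> by simp
      moreover have "linear (\<lambda>v. br (xs ! i) v)"
        using br_bilinear by (simp add: bilinear_def)
      ultimately show thesis
        using that[of "\<lambda>v. br (xs ! i) v"] len k \<open>i < j\<close> by simp
    qed
    show ?thesis
      using linear_compose[OF f(1) l] by (simp add: f(2) o_def)
  next
    case False
    let ?ys = "xs[j := br (xs ! i) (xs ! j)]"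
    have "linear (\<lambda>v. \<omega> (omit i (?ys[k := v])))"
      using CL_linear_omit[OF \<omega>, of ?ys i k] len that k False by simp
    then show ?thesis
      using False by (simp add: list_update_swap)
  qed
  show "linear (\<lambda>v. dL br M n \<omega> (xs[k := v]))"
    using len left right inner
    by (simp add: dL_def del: power_Suc)
      (intro linear_compose_add linear_compose_sub linear_compose_neg linear_compose_sum
        linear_compose_scale_right ballI; simp)
qed (simp add: dL_def)

definition linear_iso_on ::
  "('a \<Rightarrow> 'v::real_vector) set \<Rightarrow> ('b \<Rightarrow> 'w::real_vector) set \<Rightarrow>
    (('a \<Rightarrow> 'v) \<Rightarrow> ('b \<Rightarrow> 'w)) \<Rightarrow> bool" where
  "linear_iso_on V W f \<longleftrightarrow> bij_betw f V W \<and>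
     (\<forall>a\<in>V. \<forall>b\<in>V. f (\<lambda>x. a x + b x) = (\<lambda>y. f a y + f b y)) \<and>
     (\<forall>c. \<forall>a\<in>V. f (\<lambda>x. c *\<^sub>R a x) = (\<lambda>y. c *\<^sub>R f a y))"

text \<open>Only meaningful for \<open>n \<ge> 1\<close> and \<open>\<omega> \<in> CL n\<close>, when the argument of
  \<^const>\<open>Lin\<close> is linear.\<close>

definition tau :: "nat \<Rightarrow> ('g::real_vector list \<Rightarrow> 'm::real_vector) \<Rightarrow> 'g list \<Rightarrow> ('g, 'm) lin" where
  "tau n \<omega> xs = (if length xs = n - 1 then Lin (\<lambda>x. \<omega> (xs @ [x])) else 0)"

lemma tau_apply:
  assumes "\<omega> \<in> CL n" "n \<ge> 1" "length xs = n - 1"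
  shows "lin_apply (tau n \<omega> xs) x = \<omega> (xs @ [x])"
proof -
  have "linear (\<lambda>v. \<omega> ((xs @ [0])[n - 1 := v]))"
    using assms by (simp add: CL_def del: list_update_append)
  then have "linear (\<lambda>x. \<omega> (xs @ [x]))"
    unfolding assms(3)[symmetric] by simp
  then show ?thesis
    using assms by (simp add: tau_def lin_apply_Lin)
qed

end

theory Submission
  imports Defs
begin

text \<open>\<open>tau\<close> curries the last argument, so it is the isomorphism between n-linear
  maps into M and (n-1)-linear maps into Hom(g, M); uncurrying, \<open>untau\<close>, inverts it
  (\<open>linear_iso_on_tau\<close>). For the differentials (\<open>dL_tau\<close>), evaluate both
  sides at n arguments \<open>xs\<close> and then at a further \<open>y\<close>. On the
  antisymmetric side the right action is zero, leaving n left actions, the brackets inside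
  \<open>xs\<close>, and the brackets [x_i, y]. On the symmetric side there are n - 1 left actions
  and one right action on Hom(g, M); each expands into an action on M and a bracket [x_i, y], and
  the same three groups of terms appear.\<close>

lemma lin_eq_iff: "\<alpha> = \<beta> \<longleftrightarrow> (\<forall>x. lin_apply \<alpha> x = lin_apply \<beta> x)"
  by (simp add: lin_apply_inject[symmetric] fun_eq_iff)

lemma lin_apply_sum: "lin_apply (\<Sum>i\<in>A. f i) x = (\<Sum>i\<in>A. lin_apply (f i) x)"
  by (induction A rule: infinite_finite_induct) (simp_all add: zero_lin.rep_eq plus_lin.rep_eq)

lemma omit_append: "i < length xs \<Longrightarrow> omit i (xs @ ys) = omit i xs @ ys"
  by (simp add: omit_def)

lemma CL_linear: "\<omega> \<in> CL n \<Longrightarrow> length xs = n \<Longrightarrow> i < n \<Longrightarrow> linear (\<lambda>v. \<omega> (xs[i := v]))"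
  by (simp add: CL_def)

lemma CL_zero: "\<omega> \<in> CL n \<Longrightarrow> length xs \<noteq> n \<Longrightarrow> \<omega> xs = 0"
  by (simp add: CL_def)

lemma CL_add: "\<omega> \<in> CL n \<Longrightarrow> \<eta> \<in> CL n \<Longrightarrow> (\<lambda>xs. \<omega> xs + \<eta> xs) \<in> CL n"
  by (auto simp: CL_def intro: linear_compose_add)

lemma CL_scale: "\<omega> \<in> CL n \<Longrightarrow> (\<lambda>xs. c *\<^sub>R \<omega> xs) \<in> CL n"
  by (auto simp: CL_def intro: linear_compose_scale_right)

lemma tau_outside: "length xs \<noteq> n - 1 \<Longrightarrow> tau n \<omega> xs = 0"
  by (simp add: tau_def)

text \<open>Linearity of a map into Hom(g, M) can be tested after evaluation at each
  \<open>y\<close>, where it is linearity of \<omega> in one of its first n - 1 slots.\<close>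

lemma tau_CL:
  assumes \<omega>: "\<omega> \<in> CL n" and n: "n \<ge> 1"
  shows "tau n \<omega> \<in> CL (n - 1)"
  unfolding CL_def
proof (intro CollectI conjI allI impI)
  fix xs :: "'a list" and i
  assume len: "length xs = n - 1" and i: "i < n - 1"
  have "linear (\<lambda>v. \<omega> (xs[i := v] @ [y]))" for y
    using CL_linear[OF \<omega>, of "xs @ [y]" i] len i n by (simp add: list_update_append)
  then show "linear (\<lambda>v. tau n \<omega> (xs[i := v]))"
    using len by (simp add: linear_iff lin_eq_iff plus_lin.rep_eq scaleR_lin.rep_eq
        tau_apply[OF \<omega> n])
qed (simp add: tau_outside)

text \<open>Uncurrying, the inverse of \<open>tau n\<close>; the value 0 off length n follows the
  convention of \<open>CL\<close>.\<close>

definition untau :: "nat \<Rightarrow> ('g::real_vector list \<Rightarrow> ('g, 'm::real_vector) lin) \<Rightarrow> 'g list \<Rightarrow> 'm" where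
  "untau n \<beta> xs = (if length xs = n then lin_apply (\<beta> (butlast xs)) (last xs) else 0)"

text \<open>In the first n - 1 slots linearity comes from \<beta>, in the last slot from the values
  of \<beta> being linear maps.\<close>

lemma untau_CL:
  assumes \<beta>: "\<beta> \<in> CL (n - 1)" and n: "n \<ge> 1"
  shows "untau n \<beta> \<in> CL n"
  unfolding CL_def
proof (intro CollectI conjI allI impI)
  fix xs :: "'a list" and i
  assume len: "length xs = n" and i: "i < n"
  then obtain zs y where xs: "xs = zs @ [y]" by (metis gr_implies_not0 list.size(3) rev_exhaust)
  show "linear (\<lambda>v. untau n \<beta> (xs[i := v]))"
  proof (cases "i < length zs")
    case True
    have "linear (\<lambda>v. \<beta> (zs[i := v]))"
      using CL_linear[OF \<beta>, of zs i] True len xs by simp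
    then show ?thesis
      using True len xs
      by (simp add: untau_def list_update_append linear_iff plus_lin.rep_eq scaleR_lin.rep_eq)
  next
    case False
    then have "i = length zs" using i len xs by simp
    then show ?thesis
      using linear_lin_apply[of "\<beta> zs"] len xs by (simp add: untau_def)
  qed
qed (simp add: untau_def)

lemma untau_tau:
  assumes "\<omega> \<in> CL n" "n \<ge> 1"
  shows "untau n (tau n \<omega>) = \<omega>"
proof
  fix xs
  show "untau n (tau n \<omega>) xs = \<omega> xs"
  proof (cases "length xs = n")
    case True
    then have "xs \<noteq> []" using assms(2) by auto
    then show ?thesis using True by (simp add: untau_def tau_apply[OF assms])
  qed (simp add: untau_def CL_zero[OF assms(1)])
qed

lemma tau_untau:
  assumes "\<beta> \<in> CL (n - 1)" "n \<ge> 1"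
  shows "tau n (untau n \<beta>) = \<beta>"
proof
  fix xs
  show "tau n (untau n \<beta>) xs = \<beta> xs"
  proof (cases "length xs = n - 1")
    case True
    then show ?thesis
      using assms(2) by (simp add: lin_eq_iff tau_apply[OF untau_CL[OF assms] assms(2)] untau_def)
  qed (simp add: tau_outside CL_zero[OF assms(1)])
qed

lemma linear_iso_on_tau:
  assumes n: "n \<ge> 1"
  shows "linear_iso_on (CL n :: ('g::real_vector list \<Rightarrow> 'm::real_vector) set) (CL (n - 1)) (tau n)"
  unfolding linear_iso_on_def
proof (intro conjI ballI allI)
  show "bij_betw (tau n) (CL n :: ('g list \<Rightarrow> 'm) set) (CL (n - 1))"
    by (rule bij_betw_byWitness[where f' = "untau n"])
      (auto simp del: One_nat_def intro: untau_tau[OF _ n] tau_untau[OF _ n]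
        tau_CL[OF _ n] untau_CL[OF _ n])
next
  fix a b :: "'g list \<Rightarrow> 'm"
  assume a: "a \<in> CL n" and b: "b \<in> CL n"
  show "tau n (\<lambda>x. a x + b x) = (\<lambda>y. tau n a y + tau n b y)"
  proof
    fix xs
    show "tau n (\<lambda>x. a x + b x) xs = tau n a xs + tau n b xs"
      by (cases "length xs = n - 1")
        (simp_all add: lin_eq_iff plus_lin.rep_eq tau_apply[OF CL_add[OF a b] n]
          tau_apply[OF a n] tau_apply[OF b n] tau_outside del: One_nat_def)
  qed
next
  fix c and a :: "'g list \<Rightarrow> 'm"
  assume a: "a \<in> CL n"
  show "tau n (\<lambda>x. c *\<^sub>R a x) = (\<lambda>y. c *\<^sub>R tau n a y)"
  proof
    fix xs
    show "tau n (\<lambda>x. c *\<^sub>R a x) xs = c *\<^sub>R tau n a xs"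
      by (cases "length xs = n - 1")
        (simp_all add: lin_eq_iff scaleR_lin.rep_eq tau_apply[OF CL_scale[OF a] n]
          tau_apply[OF a n] tau_outside del: One_nat_def)
  qed
qed

text \<open>The correction terms \<open>-\<alpha>([x\<^sub>i, y])\<close> of the action on \<open>Hom(\<gg>, M)\<close> become the summands
  of \<open>dL \<omega>\<close> that bracket into the last argument; the sign in the right action of the symmetric
  representation makes its term the missing left action of the last remaining \<open>x\<^sub>i\<close>.\<close>

lemma (in lie_rep) dL_tau:
  assumes \<omega>: "\<omega> \<in> CL n" and n: "n \<ge> 1"
  shows "dL br (sym_rep (hom_act br act)) (n - 1) (tau n \<omega>) =
    tau (n + 1) (dL br (antisym_rep act) n \<omega>)"
proof
  fix xs
  from n obtain k where k: "n = Suc k" by (cases n) auto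
  show "dL br (sym_rep (hom_act br act)) (n - 1) (tau n \<omega>) xs =
    tau (n + 1) (dL br (antisym_rep act) n \<omega>) xs"
  proof (cases "length xs = n")
    case True
    \<comment> \<open>\<open>tau_apply\<close> can evaluate the right-hand side only because the
      coboundary is again multilinear.\<close>
    have d: "dL br (antisym_rep act) n \<omega> \<in> CL (n + 1)"
      by (rule leibniz_rep.dL_CL[OF leibniz_rep_antisym \<omega>])
    have tau: "lin_apply (tau (Suc k) \<omega> zs) y = \<omega> (zs @ [y])" if "length zs = k" for zs y
      using tau_apply[OF \<omega> n] that k by simp
    have len: "length (omit i zs) = k" if "i < n" "length zs = n" for i and zs :: "'g list"
      using that k by (simp add: length_omit)
    show ?thesis
      unfolding lin_eq_iff
    proof
      fix y
      let ?A = "\<lambda>i. (-1) ^ i *\<^sub>R act (xs ! i) (\<omega> (omit i xs @ [y]))"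
      let ?B = "\<lambda>i. (-1) ^ i *\<^sub>R \<omega> (omit i xs @ [br (xs ! i) y])"
      let ?C = "\<Sum>j<n. \<Sum>i<j. (-1) ^ (i + 1) *\<^sub>R \<omega> (omit i (xs[j := br (xs ! i) (xs ! j)]) @ [y])"
      \<comment> \<open>The terms with index k come from the right action: its sign (-1)^(k+1) and
        the minus sign in \<open>sym_rep\<close> combine to (-1)^k.\<close>
      have "lin_apply (dL br (sym_rep (hom_act br act)) (n - 1) (tau n \<omega>) xs) y
          = (\<Sum>i<k. ?A i - ?B i) + (?A k - ?B k) + ?C"
        using True k len
        by (simp add: dL_def sym_rep_def lin_apply_sum plus_lin.rep_eq uminus_lin.rep_eq
            scaleR_lin.rep_eq hom_act_apply tau scaleR_diff_right lessThan_Suc_atMost)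
      also have "\<dots> = (\<Sum>i<n. ?A i) - (\<Sum>i<n. ?B i) + ?C"
        by (simp add: k sum_subtractf)
      \<comment> \<open>In the double sum of \<open>dL\<close>, the part j < n is \<open>?C\<close>;
        the part j = n brackets into \<open>y\<close> and, with sign (-1)^(i+1), is minus the sum of
        \<open>?B\<close>.\<close>
      also have "\<dots> = dL br (antisym_rep act) n \<omega> (xs @ [y])"
        using True
        by (simp add: dL_def antisym_rep_def nth_append omit_append list_update_append sum_negf
            lessThan_Suc_atMost[symmetric])
      also have "\<dots> = lin_apply (tau (n + 1) (dL br (antisym_rep act) n \<omega>) xs) y"
        using tau_apply[OF d] True by simp
      finally show "lin_apply (dL br (sym_rep (hom_act br act)) (n - 1) (tau n \<omega>) xs) y
          = lin_apply (tau (n + 1) (dL br (antisym_rep act) n \<omega>) xs) y" .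
    qed
  \<comment> \<open>Off length n both sides are 0 by convention, as n - 1 + 1 = n for n \<ge>
    1.\<close>
  qed (simp add: dL_def tau_outside k)
qed

theorem proposition1p1:
  fixes br :: "'g::real_vector \<Rightarrow> 'g \<Rightarrow> 'g"
    and act :: "'g \<Rightarrow> 'm::real_vector \<Rightarrow> 'm"
  assumes "lie_algebra br"
    and "lie_rep br act"
  shows "\<forall>n\<ge>1.
      linear_iso_on (CL n :: ('g list \<Rightarrow> 'm) set) (CL (n - 1)) (tau n) \<and>
      (\<forall>\<omega>\<in>CL n. dL br (sym_rep (hom_act br act)) (n - 1) (tau n \<omega>) =
                 tau (n + 1) (dL br (antisym_rep act) n \<omega>))"
  using linear_iso_on_tau lie_rep.dL_tau[OF assms(2)] by blast

end
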